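(* Let $0<p<\infty$, $r>0$, and let $\alpha$ be a real number. Let $\mu$ be a positive Borel measure on $\mathbb{C}^n$. Then the following statements hold: (1) $\mu$ is a Carleson measure for $F_\alpha^p$ if and only if there is a constant $C>0$ such that $$\mu[B(z,r)]\le\frac{C}{(1+|z|)^\alpha}\qquad\text{for all } z\in\mathbb{C}^n.$$ (2) $\mu$ is a vanishing Carleson measure for $F_\alpha^p$ if and only if $$\mu[B(z,r)](1+|z|)^\alpha\to0\qquad\text{as } |z|\to\infty.$$
   Context: Fix an integer $n\ge1$. $dV$ is Lebesgue volume measure on $\mathbb{C}^n$ normalized so that $\int_{\mathbb{C}^n}e^{-|z|^2}dV(z)=1$. For $\alpha$ real and $0<p<\infty$, $F_\alpha^p$ is the space of entire functions $f$ on $\mathbb{C}^n$ with $\|f\|_{F_\alpha^p}=\left\{\int_{\mathbb{C}^n}|f(z)e^{-|z|^2/2}|^p(1+|z|)^{-\alpha}dV(z)\right\}^{1/p}<\infty$. $B(z,r)$ is the Euclidean ball with center $z\in\mathbb{C}^n$ and radius $r$. A positive Borel measure $\mu$ on $\mathbb{C}^n$ is a Carleson measure for $F_\alpha^p$ if there is a constant $C>0$ with $\int_{\mathbb{C}^n}|f(z)e^{-|z|^2/2}|^p\,d\mu(z)\le C\|f\|_{F_\alpha^p}^p$ for all $f\in F_\alpha^p$. It is a vanishing Carleson measure for $F_\alpha^p$ if $\lim_{j\to\infty}\int_{\mathbb{C}^n}|f_j(z)e^{-|z|^2/2}|^p\,d\mu(z)=0$ for every bounded sequence $\{f_j\}$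 in $F_\alpha^p$ that converges to $0$ uniformly on compact subsets of $\mathbb{C}^n$.
   Formalization: In (2) the "if" direction additionally assumes that μ is finite on compact sets; without this it fails, e.g. for an infinite point mass at 0 with f_j = 1/(j+1). Part (1) and the "only if" half of (2) are stated for all positive Borel measures. *)

theory Defs
  imports "HOL-Probability.Probability"
begin

text \<open>
  Points of complex n-space are vectors of type \<open>complex ^ 'n\<close>, with \<open>n = CARD('n) \<ge> 1\<close>; their
  \<open>norm\<close> is the Hermitian (Euclidean) norm, and \<open>lborel\<close> is the usual Lebesgue measure on the
  underlying real space of dimension \<open>2 n\<close>.
\<close>

definition dV :: "(complex ^ 'n) measure" where
  "dV = scale_measure (ennreal (1 / pi ^ CARD('n))) lborel"

lemma nn_integral_gauss: "(\<integral>\<^sup>+x. ennreal (exp (- (x::real)\<^sup>2)) \<partial>lborel) = ennreal (sqrt pi)"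
proof -
  have "has_bochner_integral lborel (\<lambda>x::real. exp (- x\<^sup>2)) (sqrt pi)"
    using has_bochner_integral_even_function[OF gaussian_moment_0] by simp
  then show ?thesis
    using nn_integral_eq_integral[of lborel "\<lambda>x::real. exp (- x\<^sup>2)"]
    by (simp add: has_bochner_integral_iff)
qed

lemma dV_normalized:
  "(\<integral>\<^sup>+z. ennreal (exp (- (norm z)\<^sup>2)) \<partial>(dV :: (complex ^ 'n) measure)) = 1"
proof -
  let ?B = "Basis :: (complex ^ 'n) set"
  have exp_eq: "ennreal (exp (- (norm z)\<^sup>2)) = (\<Prod>b\<in>?B. ennreal (exp (- (z \<bullet> b)\<^sup>2)))"
    for z :: "complex ^ 'n"
  proof -
    have "(norm z)\<^sup>2 = (\<Sum>b\<in>?B. (z \<bullet> b)\<^sup>2)"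
      unfolding power2_norm_eq_inner by (subst euclidean_inner) (simp add: power2_eq_square)
    then show ?thesis
      by (simp add: prod_ennreal exp_sum flip: sum_negf)
  qed
  have "(\<integral>\<^sup>+z. ennreal (exp (- (norm z)\<^sup>2)) \<partial>(lborel :: (complex ^ 'n) measure))
      = (\<Prod>b\<in>?B. (\<integral>\<^sup>+x. ennreal (exp (- (x::real)\<^sup>2)) \<partial>lborel))"
    unfolding exp_eq by (subst nn_integral_lborel_prod) simp_all
  also have "\<dots> = ennreal (pi ^ CARD('n))"
    unfolding nn_integral_gauss
    by (simp add: ennreal_power power_mult mult.commute[of _ 2])
  finally show ?thesis
    unfolding dV_def by (simp add: nn_integral_scale_measure flip: ennreal_mult)
qed

text \<open>
  The real Frechet derivative is required to be complex linear at every point, i.e. \<open>f\<close> is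
  complex differentiable in several variables.
\<close>

definition entire :: "(complex ^ 'n \<Rightarrow> complex) \<Rightarrow> bool" where
  "entire f \<longleftrightarrow> (\<forall>z. \<exists>f'. (f has_derivative f') (at z) \<and> (\<forall>c v. f' (c *s v) = c * f' v))"

definition weighted_power :: "real \<Rightarrow> (complex ^ 'n \<Rightarrow> complex) \<Rightarrow> complex ^ 'n \<Rightarrow> real" where
  "weighted_power p f z = (cmod (f z * of_real (exp (- (norm z)\<^sup>2 / 2)))) powr p"

definition fock_integral :: "real \<Rightarrow> real \<Rightarrow> (complex ^ 'n \<Rightarrow> complex) \<Rightarrow> ennreal" where
  "fock_integral p \<alpha> f =
     (\<integral>\<^sup>+z. ennreal (weighted_power p f z * (1 + norm z) powr (- \<alpha>)) \<partial>dV)"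

definition fock_space :: "real \<Rightarrow> real \<Rightarrow> (complex ^ 'n \<Rightarrow> complex) set" where
  "fock_space p \<alpha> = {f. entire f \<and> fock_integral p \<alpha> f < \<infinity>}"

text \<open>Only meaningful on \<open>fock_space p \<alpha>\<close>: \<open>enn2real\<close> sends an infinite integral to \<open>0\<close>.\<close>

definition fock_norm :: "real \<Rightarrow> real \<Rightarrow> (complex ^ 'n \<Rightarrow> complex) \<Rightarrow> real" where
  "fock_norm p \<alpha> f = enn2real (fock_integral p \<alpha> f) powr (1 / p)"

definition carleson_measure :: "real \<Rightarrow> real \<Rightarrow> (complex ^ 'n) measure \<Rightarrow> bool" where
  "carleson_measure p \<alpha> \<mu> \<longleftrightarrow>
     (\<exists>C>0. \<forall>f\<in>fock_space p \<alpha>.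
        (\<integral>\<^sup>+z. ennreal (weighted_power p f z) \<partial>\<mu>) \<le> ennreal (C * fock_norm p \<alpha> f powr p))"

definition vanishing_carleson_measure :: "real \<Rightarrow> real \<Rightarrow> (complex ^ 'n) measure \<Rightarrow> bool" where
  "vanishing_carleson_measure p \<alpha> \<mu> \<longleftrightarrow>
     (\<forall>f :: nat \<Rightarrow> complex ^ 'n \<Rightarrow> complex.
        (\<forall>j. f j \<in> fock_space p \<alpha>) \<longrightarrow>
        (\<exists>M. \<forall>j. fock_norm p \<alpha> (f j) \<le> M) \<longrightarrow>
        (\<forall>K. compact K \<longrightarrow> uniform_limit K f (\<lambda>z. 0) sequentially) \<longrightarrow>
        (\<lambda>j. \<integral>\<^sup>+z. ennreal (weighted_power p (f j) z) \<partial>\<mu>) \<longlonglongrightarrow> 0)"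

text \<open>
  The usual convention for positive Borel measures in this setting. The growth condition
  on \<open>\<mu> (ball z r)\<close> as \<open>z\<close> tends to infinity says nothing about bounded sets: an infinite point mass
  at \<open>0\<close> satisfies it, but is not a vanishing Carleson measure (take the constants
  \<open>f j = 1 / (j + 1)\<close>). Conversely, a Carleson or vanishing Carleson measure is automatically finite on compact sets.
\<close>

definition finite_on_compacts :: "(complex ^ 'n) measure \<Rightarrow> bool" where
  "finite_on_compacts \<mu> \<longleftrightarrow> (\<forall>K. compact K \<longrightarrow> emeasure \<mu> K < \<infinity>)"

end

theory Submission
  imports Defs "HOL-Complex_Analysis.Complex_Analysis" "HOL-Real_Asymp.Real_Asymp"
begin

text \<open>
  Sufficiency rests on the local estimate
  \<open>|f(z) e^(-|z|^2/2)|^p \<le> C \<integral> |f(u) e^(-|u|^2/2)|^p dV(u)\<close>, integrated over \<open>u \<in> B(z,r)\<close>.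
  Integrating it against \<open>\<mu>\<close> and exchanging the integrals bounds the \<open>\<mu>\<close>-integral by the integral of
  \<open>|f(u) e^(-|u|^2/2)|^p \<mu>(B(u,r))\<close> against \<open>dV\<close>, into which the hypothesis on \<open>\<mu>(B(u,r))\<close> is
  inserted; in the vanishing case a large ball, where \<open>f_j \<rightarrow> 0\<close> uniformly, is split off.
  The local estimate needs no subharmonicity of \<open>|f|^p\<close>: it follows from the Cauchy
  estimate at a maximum of \<open>|f(z)|^p (r - |z|)^(2n)\<close>.

  For necessity one tests on the normalised reproducing kernels \<open>exp(<z,w> - |w|^2/2)\<close>, whose weighted
  modulus is \<open>exp(-|z-w|^2/2)\<close>; Peetre's inequality compares the weights at \<open>z\<close> and \<open>w\<close>.
\<close>

section \<open>Local estimates for entire functions\<close>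

lemma norm_vector_smult: "norm (c *s v) = cmod c * norm (v :: complex ^ 'n)"
  by (simp add: norm_vec_def L2_set_right_distrib norm_mult)

lemma bounded_linear_vector_smult_left: "bounded_linear (\<lambda>c::complex. c *s (v :: complex ^ 'n))"
  unfolding linear_conv_bounded_linear[symmetric]
  by (rule linearI) (simp_all add: vec_eq_iff algebra_simps)

text \<open>Restriction to complex lines reduces the estimates in several variables to Cauchy theory
  in one. Complex linearity of the derivative is what makes \<open>f' v\<close> a complex derivative
  of the restriction.\<close>

lemma entire_along_line:
  fixes f :: "complex ^ 'n \<Rightarrow> complex"
  assumes "entire f"
  shows "(\<lambda>\<zeta>. f (a + \<zeta> *s v)) holomorphic_on S"
  unfolding holomorphic_on_def field_differentiable_def
proof
  fix \<zeta>
  obtain f' where f': "(f has_derivative f') (at (a + \<zeta> *s v))" "\<And>c v. f' (c *s v) = c * f' v"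
    using assms unfolding entire_def by blast
  have "((\<lambda>\<zeta>. a + \<zeta> *s v) has_derivative (\<lambda>h. h *s v)) (at \<zeta>)"
    using has_derivative_add[OF has_derivative_const[of a]
        bounded_linear.has_derivative[OF bounded_linear_vector_smult_left has_derivative_ident]]
    by simp
  from has_derivative_compose[OF this f'(1)]
  have "((\<lambda>\<zeta>. f (a + \<zeta> *s v)) has_field_derivative f' v) (at \<zeta>)"
    unfolding has_field_derivative_def by (simp add: f'(2) mult.commute[of _ "f' v"])
  then show "\<exists>D. ((\<lambda>\<zeta>. f (a + \<zeta> *s v)) has_field_derivative D) (at \<zeta> within S)"
    using has_field_derivative_at_within by blast
qed

lemma entire_continuous_on: "entire f \<Longrightarrow> continuous_on S f"
  unfolding entire_def
  by (meson continuous_at_imp_continuous_on has_derivative_continuous)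

text \<open>On the complex line through \<open>a\<close> and \<open>u\<close>, parametrised by a
  unit vector, the Cauchy estimate bounds the derivative by \<open>4 * M / R\<close> on the disc of
  radius \<open>R / 4\<close>, and the mean value inequality on that disc gives the claim.\<close>

lemma entire_oscillation_le:
  fixes f :: "complex ^ 'n \<Rightarrow> complex"
  assumes f: "entire f" and R: "0 < R"
    and bound: "\<And>u. u \<in> ball a R \<Longrightarrow> cmod (f u) \<le> M" and u: "dist a u \<le> R / 4"
  shows "cmod (f u - f a) \<le> 4 * M / R * dist a u"
proof (cases "u = a")
  case False
  define t where "t = dist a u"
  have t: "0 < t" "t \<le> R / 4" using False u by (auto simp: t_def)
  define v where "v = complex_of_real (1 / t) *s (u - a)"
  have nv: "norm v = 1"
    unfolding v_def norm_vector_smult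
    using t by (simp add: t_def dist_norm norm_minus_commute norm_divide)
  define h where "h = (\<lambda>\<zeta>. f (a + \<zeta> *s v))"
  have holo: "h holomorphic_on S" for S
    unfolding h_def by (rule entire_along_line[OF f])
  have hb: "cmod (h \<zeta>) \<le> M" if "cmod \<zeta> < R" for \<zeta>
    unfolding h_def using that by (intro bound) (simp add: dist_norm norm_vector_smult nv)
  have "cmod (deriv h \<xi>) \<le> 4 * M / R" if "\<xi> \<in> cball 0 (R / 4)" for \<xi>
  proof -
    \<comment> \<open>The circle of radius \<open>R / 4\<close> about a point of
      \<open>cball 0 (R / 4)\<close> stays within distance \<open>R / 2\<close> of the origin, where
      \<open>hb\<close> applies.\<close>
    have "cmod ((deriv ^^ 1) h \<xi>) \<le> fact 1 * M / (R / 4) ^ 1"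
    proof (rule Cauchy_inequality)
      fix x assume "cmod (\<xi> - x) = R / 4"
      then have "cmod x \<le> R / 4 + R / 4"
        using norm_triangle_ineq4[of \<xi> "\<xi> - x"] that by simp
      then show "cmod (h x) \<le> M" using R by (intro hb) simp
    qed (use R in \<open>auto intro: holo holomorphic_on_imp_continuous_on\<close>)
    then show ?thesis by (simp add: field_simps)
  qed
  then have "cmod (h t - h 0) \<le> 4 * M / R * cmod (of_real t - 0)"
    by (rule field_differentiable_bound[OF convex_cball[of 0 "R / 4"], rotated 1])
      (use R t holo[of UNIV] in \<open>auto intro!: DERIV_subset[OF holomorphic_derivI[of h UNIV]]\<close>)
  moreover have "complex_of_real t *s v = u - a"
    using t by (simp add: v_def vector_smult_assoc flip: of_real_mult)
  ultimately show ?thesis using t by (simp add: h_def flip: t_def)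
qed simp

text \<open>The power of the distance to the boundary is the real dimension \<open>m\<close>, so
  that at the maximum point the factor \<open>d ^ m\<close> matches the volume of a ball of radius
  proportional to \<open>d\<close>. The proportion depends only on \<open>p\<close> and
  \<open>m\<close>, which makes the constant uniform in \<open>g\<close>.\<close>

lemma cmod_powr_submean:
  assumes p: "0 < p" and r: "0 < r"
  obtains C :: real where "0 < C"
    "\<And>g :: complex ^ 'n \<Rightarrow> complex. entire g \<Longrightarrow> ennreal (cmod (g 0) powr p) \<le>
       ennreal C * (\<integral>\<^sup>+u. ennreal (cmod (g u) powr p) * indicator (ball 0 r) u \<partial>lborel)"
proof
  define m where "m = DIM(complex ^ 'n)"
  have m: "0 < m" by (simp add: m_def)
  \<comment> \<open>Within distance \<open>d / 2\<close> of the maximum point found below, the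
    distance to the boundary is at least \<open>d / 2\<close>. Maximality thus lets
    \<open>cmod (g u) powr p\<close> exceed its value at that point by a factor of at most
    \<open>2 ^ m\<close>, and \<open>K\<close> is the \<open>p\<close>-th root of this
    factor.\<close>
  define K where "K = (2::real) powr (real m / p)"
  have K1: "1 \<le> K" using p by (simp add: K_def ge_one_powr_ge_zero)
  have Kp: "K powr p = 2 ^ m" using p by (simp add: K_def powr_powr powr_realpow)
  \<comment> \<open>Chosen so that \<open>a powr p * d ^ m * c\<close> is
    \<open>(a / 2) powr p\<close> times the volume of a ball of radius
    \<open>d / (16 * K)\<close>.\<close>
  define c where "c = (1/2) powr p * unit_ball_vol (real m) / (16 * K) ^ m"
  have c: "0 < c" using K1 by (simp add: c_def)
  show "0 < 1 / (r ^ m * c)" using r c by simp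
  fix g :: "complex ^ 'n \<Rightarrow> complex" assume g: "entire g"
  let ?I = "\<integral>\<^sup>+u. ennreal (cmod (g u) powr p) * indicator (ball 0 r) u \<partial>lborel"
  show "ennreal (cmod (g 0) powr p) \<le> ennreal (1 / (r ^ m * c)) * ?I"
  proof (cases "g 0 = 0")
    case False
    \<comment> \<open>At a maximum \<open>z0\<close> of \<open>\<phi>\<close>, the values of \<open>g\<close> near \<open>z0\<close> are controlled by \<open>g z0\<close> itself, so
      the Cauchy estimate yields a ball of comparable size on which \<open>cmod g \<ge> cmod (g z0) / 2\<close>.\<close>
    define \<phi> where "\<phi> u = cmod (g u) powr p * (r - norm u) ^ m" for u
    have "continuous_on (cball 0 r) \<phi>"
      unfolding \<phi>_def using p
      by (intro continuous_intros continuous_on_powr' entire_continuous_on g) auto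
    then obtain z0 where z0: "z0 \<in> cball 0 r" and max: "\<And>u. u \<in> cball 0 r \<Longrightarrow> \<phi> u \<le> \<phi> z0"
      using continuous_attains_sup[of "cball 0 r" \<phi>] r by auto
    define a d where "a = cmod (g z0)" and "d = r - norm z0"
    have \<phi>0: "cmod (g 0) powr p * r ^ m \<le> a powr p * d ^ m"
      using max[of 0] r by (simp add: \<phi>_def a_def d_def)
    moreover have "0 < cmod (g 0) powr p * r ^ m" using False r by simp
    ultimately have "0 < a powr p * d ^ m" by simp
    moreover have "0 \<le> d" using z0 by (simp add: d_def)
    \<comment> \<open>Positivity of the product excludes \<open>d = 0\<close>: the maximum is
      attained in the open ball.\<close>
    ultimately have a: "0 < a" and d: "0 < d"
      using m by (auto simp: a_def zero_less_mult_iff power_0_left intro: le_neq_trans)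
    have bd: "cmod (g u) \<le> K * a" if "u \<in> ball z0 (d / 2)" for u
    proof (rule ccontr)
      have "dist z0 u < d / 2" "norm u \<le> norm z0 + dist z0 u"
        using that norm_triangle_ineq[of z0 "u - z0"] by (simp_all add: dist_norm norm_minus_commute)
      moreover have "norm z0 = r - d" by (simp add: d_def)
      ultimately have nu: "norm u \<le> r - d / 2" by linarith
      assume "\<not> cmod (g u) \<le> K * a"
      then have "(K * a) powr p < cmod (g u) powr p"
        using K1 a p by (intro powr_less_mono2) auto
      then have "2 ^ m * a powr p < cmod (g u) powr p"
        using K1 a by (simp add: powr_mult Kp)
      then have "a powr p * d ^ m < cmod (g u) powr p * (d / 2) ^ m"
        using d by (simp add: field_simps)
      also have "\<dots> \<le> \<phi> u"
        unfolding \<phi>_def using nu d by (intro mult_left_mono power_mono) auto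
      also have "\<dots> \<le> \<phi> z0" using nu d by (intro max) simp
      finally show False by (simp add: \<phi>_def a_def d_def)
    qed
    \<comment> \<open>With \<open>K * a\<close> as bound and \<open>d / 2\<close> as radius, the
      oscillation estimate at distance \<open>s\<close> gives exactly \<open>a / 2\<close>. Since
      \<open>1 \<le> K\<close>, \<open>s\<close> is also below the quarter radius
      \<open>d / 8\<close> that this estimate requires.\<close>
    define s where "s = d / (16 * K)"
    have s: "0 < s" "s \<le> d / 16" using d K1 by (auto simp: s_def field_simps)
    have low: "a / 2 \<le> cmod (g u)" if "u \<in> ball z0 s" for u
    proof -
      have "cmod (g u - g z0) \<le> 4 * (K * a) / (d / 2) * dist z0 u"
        using that s d by (intro entire_oscillation_le g bd) auto
      also have "\<dots> \<le> 4 * (K * a) / (d / 2) * s"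
        using that d K1 a by (intro mult_left_mono) auto
      also have "\<dots> = a / 2" using d K1 by (simp add: s_def field_simps)
      finally show ?thesis
        using norm_triangle_ineq3[of "g u" "g z0"] by (simp add: a_def)
    qed
    have "ennreal (cmod (g 0) powr p) * ennreal (r ^ m * c) = ennreal (cmod (g 0) powr p * r ^ m * c)"
      by (simp add: mult.assoc ennreal_mult')
    also have "\<dots> \<le> ennreal (a powr p * d ^ m * c)"
      using \<phi>0 c by (intro ennreal_leI mult_right_mono) auto
    also have "\<dots> = ennreal ((a / 2) powr p) * emeasure lborel (ball z0 s)"
      using s a d K1 by (subst emeasure_ball)
        (auto simp: c_def s_def powr_divide power_divide powr_one_eq_one m_def ac_simps simp flip: ennreal_mult')
    also have "\<dots> = (\<integral>\<^sup>+u. ennreal ((a / 2) powr p) * indicator (ball z0 s) u \<partial>lborel)"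
      by (simp add: nn_integral_cmult_indicator)
    also have "\<dots> \<le> ?I"
    proof (rule nn_integral_mono)
      fix u
      have "u \<in> ball 0 r" if "u \<in> ball z0 s"
        using that s d norm_triangle_ineq[of z0 "u - z0"]
        by (simp add: d_def dist_norm norm_minus_commute)
      then show "ennreal ((a / 2) powr p) * indicator (ball z0 s) u
          \<le> ennreal (cmod (g u) powr p) * indicator (ball 0 r) u"
        using low[of u] a p by (auto simp: indicator_def intro!: ennreal_leI powr_mono2)
    qed
    finally have "ennreal (1 / (r ^ m * c)) * (ennreal (cmod (g 0) powr p) * ennreal (r ^ m * c))
        \<le> ennreal (1 / (r ^ m * c)) * ?I"
      by (rule mult_left_mono) simp
    then show ?thesis
      using r c by (simp add: ac_simps flip: ennreal_mult')
  qed simp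
qed

section \<open>Recentring: the local estimate with the Gaussian weight\<close>

definition hermitian :: "complex ^ 'n \<Rightarrow> complex ^ 'n \<Rightarrow> complex" where
  "hermitian u w = (\<Sum>i\<in>UNIV. u $ i * cnj (w $ i))"

lemma Re_hermitian: "Re (hermitian u w) = u \<bullet> w"
  by (simp add: hermitian_def inner_vec_def inner_complex_def)

lemma hermitian_smult_left: "hermitian (c *s u) w = c * hermitian u w"
  by (simp add: hermitian_def sum_distrib_left mult.assoc)

lemma bounded_linear_hermitian: "bounded_linear (\<lambda>u. hermitian u w)"
  unfolding linear_conv_bounded_linear[symmetric]
  by (rule linearI) (simp_all add: hermitian_def algebra_simps sum.distrib scaleR_sum_right)

text \<open>One closure property serves two purposes: it recentres a given function at
  \<open>a\<close> with a Gaussian correction, and, applied to a constant function, it produces the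
  reproducing kernels. Linearity of \<open>hermitian\<close> in its first argument is what keeps the
  exponential entire.\<close>

lemma entire_twist:
  assumes "entire f"
  shows "entire (\<lambda>u. f (a + u) * exp (hermitian u w + c))"
  unfolding entire_def
proof
  fix z
  obtain f' where f': "(f has_derivative f') (at (a + z))" "\<And>c v. f' (c *s v) = c * f' v"
    using assms unfolding entire_def by blast
  have 1: "((\<lambda>u. f (a + u)) has_derivative f') (at z)"
    by (rule has_derivative_compose[where f = "\<lambda>u. a + u" and g = f, OF _ f'(1)])
      (auto intro!: derivative_eq_intros)
  have "((\<lambda>u. hermitian u w + c) has_derivative (\<lambda>h. hermitian h w)) (at z)"
    using has_derivative_add[OF bounded_linear.has_derivative[OF bounded_linear_hermitian has_derivative_ident]
        has_derivative_const[of c]] by simp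
  from has_derivative_compose[OF this, of exp "(*) (exp (hermitian z w + c))"]
  have 2: "((\<lambda>u. exp (hermitian u w + c)) has_derivative
      (\<lambda>h. exp (hermitian z w + c) * hermitian h w)) (at z)"
    using DERIV_exp unfolding has_field_derivative_def by blast
  show "\<exists>D. ((\<lambda>u. f (a + u) * exp (hermitian u w + c)) has_derivative D) (at z) \<and>
      (\<forall>c v. D (c *s v) = c * D v)"
    by (rule exI, rule conjI, rule has_derivative_mult[OF 1 2])
      (simp add: f'(2) hermitian_smult_left algebra_simps)
qed

lemma weighted_power_eq: "weighted_power p f z = cmod (f z) powr p * exp (- p * (norm z)\<^sup>2 / 2)"
  by (simp add: weighted_power_def norm_mult powr_mult exp_powr_real mult.commute)

lemma weighted_power_nonneg: "0 \<le> weighted_power p f z"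
  by (simp add: weighted_power_def)

lemma measurable_weighted_power:
  assumes "entire f" shows "weighted_power p f \<in> borel_measurable borel"
proof -
  have [measurable]: "f \<in> borel_measurable borel"
    by (intro borel_measurable_continuous_onI entire_continuous_on assms)
  show ?thesis unfolding weighted_power_def by measurable
qed

lemma nn_integral_lborel_eq_dV:
  fixes f :: "complex ^ 'n \<Rightarrow> ennreal"
  assumes "f \<in> borel_measurable borel"
  shows "(\<integral>\<^sup>+u. f u \<partial>lborel) = ennreal (pi ^ CARD('n)) * (\<integral>\<^sup>+u. f u \<partial>dV)"
  unfolding dV_def using assms
  by (simp add: nn_integral_scale_measure flip: mult.assoc ennreal_mult')

text \<open>The unweighted estimate at the origin is applied to a twisted translate of
  \<open>f\<close>. On \<open>ball 0 r\<close> the remaining Gaussian is at least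
  \<open>exp (- p * r\<^sup>2 / 2)\<close>, so the weight costs only a factor independent of
  \<open>z\<close>.\<close>

lemma weighted_power_submean:
  assumes p: "0 < p" and r: "0 < r"
  obtains C :: real where "0 < C"
    "\<And>(f :: complex ^ 'n \<Rightarrow> complex) z. entire f \<Longrightarrow> ennreal (weighted_power p f z) \<le>
       ennreal C * (\<integral>\<^sup>+u. ennreal (weighted_power p f u) * indicator (ball z r) u \<partial>lborel)"
proof -
  obtain C :: real where C: "0 < C"
    "\<And>g :: complex ^ 'n \<Rightarrow> complex. entire g \<Longrightarrow> ennreal (cmod (g 0) powr p) \<le>
       ennreal C * (\<integral>\<^sup>+u. ennreal (cmod (g u) powr p) * indicator (ball 0 r) u \<partial>lborel)"
    by (rule cmod_powr_submean[OF p r]) (rule that; blast)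
  show ?thesis
  proof
    show "0 < C * exp (p * r\<^sup>2 / 2)" using C by simp
    fix f :: "complex ^ 'n \<Rightarrow> complex" and z assume f: "entire f"
    note [measurable] = measurable_weighted_power[OF f]
    have meas: "(\<lambda>u. ennreal (weighted_power p f u) * indicator (ball z r) u) \<in> borel_measurable borel"
      by (intro borel_measurable_times_ennreal borel_measurable_indicator
          measurable_compose[OF measurable_weighted_power[OF f] measurable_ennreal]) auto
    \<comment> \<open>The exponential factor turns the Gaussian weight at \<open>z + u\<close> into the one at \<open>u\<close>.\<close>
    define g where "g u = f (z + u) * exp (hermitian u (- z) + of_real (- (norm z)\<^sup>2 / 2))" for u
    have g: "entire g" unfolding g_def by (rule entire_twist[OF f])
    have wp: "weighted_power p f (z + u) = cmod (g u) powr p * exp (- p * (norm u)\<^sup>2 / 2)" for u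
      unfolding weighted_power_eq g_def power2_norm_eq_inner
      by (simp add: norm_mult powr_mult exp_powr_real Re_hermitian algebra_simps inner_commute
          add_divide_distrib diff_divide_distrib flip: exp_add)
    have "ennreal (weighted_power p f z) = ennreal (cmod (g 0) powr p)"
      using wp[of 0] by simp
    also have "\<dots> \<le> ennreal C * (\<integral>\<^sup>+u. ennreal (cmod (g u) powr p) * indicator (ball 0 r) u \<partial>lborel)"
      by (rule C(2)[OF g])
    also have "(\<integral>\<^sup>+u. ennreal (cmod (g u) powr p) * indicator (ball 0 r) u \<partial>lborel)
        \<le> (\<integral>\<^sup>+u. ennreal (exp (p * r\<^sup>2 / 2)) * (ennreal (weighted_power p f (z + u)) * indicator (ball z r) (z + u)) \<partial>lborel)"
    proof (rule nn_integral_mono)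
      fix u
      have "cmod (g u) powr p \<le> exp (p * r\<^sup>2 / 2) * weighted_power p f (z + u)" if "norm u < r"
      proof -
        have "(norm u)\<^sup>2 \<le> r\<^sup>2" using that by (intro power_mono) auto
        then have "1 \<le> exp (p * r\<^sup>2 / 2 + - p * (norm u)\<^sup>2 / 2)" using p by simp
        from mult_left_mono[OF this, of "cmod (g u) powr p"]
        show ?thesis unfolding wp exp_add by (simp add: ac_simps)
      qed
      then show "ennreal (cmod (g u) powr p) * indicator (ball 0 r) u
        \<le> ennreal (exp (p * r\<^sup>2 / 2)) * (ennreal (weighted_power p f (z + u)) * indicator (ball z r) (z + u))"
        by (auto simp: indicator_def dist_norm intro!: ennreal_leI simp flip: ennreal_mult')
    qed
    \<comment> \<open>The substitution \<open>z + u\<close> is a push-forward of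
      \<open>lborel\<close> under a translation, which leaves \<open>lborel\<close>
      unchanged.\<close>
    also have "\<dots> = (\<integral>\<^sup>+u. ennreal (exp (p * r\<^sup>2 / 2)) *
        (ennreal (weighted_power p f u) * indicator (ball z r) u) \<partial>distr lborel borel ((+) z))"
      by (rule nn_integral_distr[symmetric])
        (use meas in \<open>auto intro!: borel_measurable_times_ennreal\<close>)
    also have "\<dots> = ennreal (exp (p * r\<^sup>2 / 2)) *
        (\<integral>\<^sup>+u. ennreal (weighted_power p f u) * indicator (ball z r) u \<partial>distr lborel borel ((+) z))"
      using meas by (intro nn_integral_cmult) simp
    finally show "ennreal (weighted_power p f z) \<le> ennreal (C * exp (p * r\<^sup>2 / 2)) *
       (\<integral>\<^sup>+u. ennreal (weighted_power p f u) * indicator (ball z r) u \<partial>lborel)"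
      using C(1) by (simp add: lborel_distr_plus ennreal_mult' mult.assoc mult_left_mono)
  qed
qed

section \<open>Exchanging the measures\<close>

text \<open>Finitely many balls of the one radius \<open>r\<close> cover a compact set. In the
  Carleson case this turns the growth bound into local finiteness, hence into the sigma-finiteness
  behind the exchange of integrals.\<close>

lemma finite_on_compacts_if_finite_on_balls:
  fixes \<mu> :: "(complex ^ 'n) measure"
  assumes "sets \<mu> = sets borel" "0 < r" "\<And>z. emeasure \<mu> (ball z r) < \<infinity>"
  shows "finite_on_compacts \<mu>"
  unfolding finite_on_compacts_def
proof (intro allI impI)
  fix K :: "(complex ^ 'n) set" assume "compact K"
  then obtain D where D: "D \<subseteq> K" "finite D" "K \<subseteq> (\<Union>c\<in>D. ball c r)"
    using \<open>0 < r\<close> by (elim compactE_image[where C = K and f = "\<lambda>c. ball c r"]) auto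
  have "emeasure \<mu> K \<le> emeasure \<mu> (\<Union>c\<in>D. ball c r)"
    using D by (intro emeasure_mono) (auto simp: assms(1))
  also have "\<dots> \<le> (\<Sum>c\<in>D. emeasure \<mu> (ball c r))"
    using D by (intro emeasure_subadditive_finite) (auto simp: assms(1))
  also have "\<dots> < \<infinity>"
    using D assms(3) by (auto simp: less_top[symmetric])
  finally show "emeasure \<mu> K < \<infinity>" .
qed

lemma sigma_finite_if_finite_on_compacts:
  fixes \<mu> :: "(complex ^ 'n) measure"
  assumes sets: "sets \<mu> = sets borel" and fin: "finite_on_compacts \<mu>"
  shows "sigma_finite_measure \<mu>"
proof
  let ?A = "range (\<lambda>n. cball 0 (real n)) :: (complex ^ 'n) set set"
  have "x \<in> \<Union>?A" for x :: "complex ^ 'n"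
    using real_arch_simple[of "norm x"] by auto
  then show "\<exists>A. countable A \<and> A \<subseteq> sets \<mu> \<and> \<Union>A = space \<mu> \<and> (\<forall>a\<in>A. emeasure \<mu> a \<noteq> \<infinity>)"
    using fin sets_eq_imp_space_eq[OF sets] unfolding finite_on_compacts_def
    by (intro exI[of _ ?A]) (auto simp: sets less_top)
qed

text \<open>The conditions \<open>u \<in> ball z r\<close> and \<open>z \<in> ball u r\<close>
  coincide, so after the exchange the inner integral over \<open>z\<close> is the measure of
  \<open>ball u r\<close>.\<close>

lemma nn_integral_weighted_power_le:
  fixes \<mu> :: "(complex ^ 'n) measure"
  assumes p: "0 < p" and r: "0 < r" and sets: "sets \<mu> = sets borel" and fin: "finite_on_compacts \<mu>"
  obtains C :: real where "0 < C"
    "\<And>f. entire f \<Longrightarrow> (\<integral>\<^sup>+z. ennreal (weighted_power p f z) \<partial>\<mu>) \<le>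
       ennreal C * (\<integral>\<^sup>+u. ennreal (weighted_power p f u) * emeasure \<mu> (ball u r) \<partial>dV)"
proof -
  obtain C :: real where C: "0 < C"
    "\<And>(f :: complex ^ 'n \<Rightarrow> complex) z. entire f \<Longrightarrow> ennreal (weighted_power p f z) \<le>
       ennreal C * (\<integral>\<^sup>+u. ennreal (weighted_power p f u) * indicator (ball z r) u \<partial>lborel)"
    by (rule weighted_power_submean[OF p r]) (rule that; blast)
  interpret \<mu>: sigma_finite_measure \<mu> by (rule sigma_finite_if_finite_on_compacts[OF sets fin])
  interpret pair_sigma_finite lborel \<mu> ..
  note [measurable_cong] = sets
  \<comment> \<open>Being open, \<open>Q\<close> is Borel in the product. This yields both the joint
    measurability needed for the exchange and, through its sections, the measurability of the
    measure of \<open>ball u r\<close> in \<open>u\<close>.\<close>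
  define Q where "Q = {x :: (complex ^ 'n) \<times> (complex ^ 'n). dist (fst x) (snd x) < r}"
  have "open Q" unfolding Q_def by (intro open_Collect_less continuous_intros)
  then have Q: "Q \<in> sets (borel \<Otimes>\<^sub>M borel)" unfolding borel_prod by (rule borel_open)
  then have Q\<mu>: "Q \<in> sets (borel \<Otimes>\<^sub>M \<mu>)" "Q \<in> sets (lborel \<Otimes>\<^sub>M \<mu>)"
    by (simp_all cong: sets_pair_measure_cong add: sets)
  have "(\<lambda>u. emeasure \<mu> (Pair u -` Q)) \<in> borel_measurable borel"
    by (rule \<mu>.measurable_emeasure_Pair[OF Q\<mu>(1)])
  then have ball[measurable]: "(\<lambda>u. emeasure \<mu> (ball u r)) \<in> borel_measurable borel"
    by (simp add: Q_def ball_def)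
  show ?thesis
  proof
    show "0 < C * pi ^ CARD('n)" using C by simp
    fix f :: "complex ^ 'n \<Rightarrow> complex" assume f: "entire f"
    note wp[measurable] = measurable_weighted_power[OF f, of p]
    let ?F = "\<lambda>u z. ennreal C * (ennreal (weighted_power p f u) * indicator Q (u, z))"
    have ind: "indicator (ball z r) u = (indicator Q (u, z) :: ennreal)" for u z
      by (simp add: indicator_def Q_def dist_commute)
    have "(\<lambda>u. ennreal (weighted_power p f u) * indicator (ball z r) u) \<in> borel_measurable lborel" for z
      by (intro borel_measurable_times_ennreal borel_measurable_indicator
          measurable_compose[OF _ measurable_ennreal]) (use wp in auto)
    then have "(\<integral>\<^sup>+z. ennreal (weighted_power p f z) \<partial>\<mu>) \<le> (\<integral>\<^sup>+z. (\<integral>\<^sup>+u. ?F u z \<partial>lborel) \<partial>\<mu>)"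
      using C(2)[OF f] by (intro nn_integral_mono) (simp add: nn_integral_cmult flip: ind)
    also have "\<dots> = (\<integral>\<^sup>+u. (\<integral>\<^sup>+z. ?F u z \<partial>\<mu>) \<partial>lborel)"
    proof (rule Fubini')
      have "(\<lambda>x. ennreal (weighted_power p f (fst x))) \<in> borel_measurable (lborel \<Otimes>\<^sub>M \<mu>)"
        by (rule measurable_compose[OF measurable_fst]) (use wp in simp)
      then have "(\<lambda>x. ennreal C * (ennreal (weighted_power p f (fst x)) * indicator Q x)) \<in> borel_measurable (lborel \<Otimes>\<^sub>M \<mu>)"
        by (intro borel_measurable_times_ennreal borel_measurable_indicator Q\<mu>(2)
            borel_measurable_const)
      then show "case_prod ?F \<in> borel_measurable (lborel \<Otimes>\<^sub>M \<mu>)"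
        by (simp add: case_prod_unfold)
    qed
    also have "\<dots> = (\<integral>\<^sup>+u. ennreal C * (ennreal (weighted_power p f u) * emeasure \<mu> (ball u r)) \<partial>lborel)"
    proof (rule nn_integral_cong)
      fix u
      have "indicator Q (u, z) = (indicator (ball u r) z :: ennreal)" for z
        by (simp add: indicator_def Q_def)
      then have "(\<integral>\<^sup>+z. ?F u z \<partial>\<mu>) =
          (\<integral>\<^sup>+z. (ennreal C * ennreal (weighted_power p f u)) * indicator (ball u r) z \<partial>\<mu>)"
        by (simp add: mult.assoc)
      also have "\<dots> = (ennreal C * ennreal (weighted_power p f u)) * emeasure \<mu> (ball u r)"
        by (rule nn_integral_cmult_indicator) (simp add: sets)
      finally show "(\<integral>\<^sup>+z. ?F u z \<partial>\<mu>) = ennreal C * (ennreal (weighted_power p f u) * emeasure \<mu> (ball u r))"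
        by (simp only: mult.assoc)
    qed
    also have "\<dots> = ennreal C * (\<integral>\<^sup>+u. ennreal (weighted_power p f u) * emeasure \<mu> (ball u r) \<partial>lborel)"
      by (rule nn_integral_cmult) simp
    also have "(\<integral>\<^sup>+u. ennreal (weighted_power p f u) * emeasure \<mu> (ball u r) \<partial>lborel) =
        ennreal (pi ^ CARD('n)) * (\<integral>\<^sup>+u. ennreal (weighted_power p f u) * emeasure \<mu> (ball u r) \<partial>dV)"
      by (rule nn_integral_lborel_eq_dV) simp
    finally show "(\<integral>\<^sup>+z. ennreal (weighted_power p f z) \<partial>\<mu>) \<le> ennreal (C * pi ^ CARD('n)) *
        (\<integral>\<^sup>+u. ennreal (weighted_power p f u) * emeasure \<mu> (ball u r) \<partial>dV)"
      using C(1) by (simp add: ennreal_mult' mult.assoc)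
  qed
qed

section \<open>Test functions\<close>

text \<open>The triangle inequality gives the case \<open>b = 1\<close>, and monotonicity of powers
  every \<open>b \<ge> 0\<close>. For negative \<open>b\<close> the roles of \<open>z\<close> and
  \<open>w\<close> are exchanged and reciprocals taken.\<close>

lemma peetre_inequality:
  fixes z w :: "'a :: real_normed_vector"
  shows "(1 + norm z) powr b \<le> (1 + norm w) powr b * (1 + norm (z - w)) powr \<bar>b\<bar>"
proof -
  have le: "1 + norm x \<le> (1 + norm y) * (1 + norm (x - y))" for x y :: 'a
  proof -
    have "norm x \<le> norm y + norm (x - y)" using norm_triangle_ineq[of y "x - y"] by simp
    moreover have "0 \<le> norm y * norm (x - y)" by simp
    moreover have "(1 + norm y) * (1 + norm (x - y)) = 1 + norm y + norm (x - y) + norm y * norm (x - y)"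
      by (simp add: algebra_simps)
    ultimately show ?thesis by linarith
  qed
  show ?thesis
  proof (cases "0 \<le> b")
    case True
    then show ?thesis
      using powr_mono2[OF True _ le[of z w]] by (simp add: powr_mult)
  next
    case False
    then have "(1 + norm w) powr (- b) \<le> ((1 + norm z) * (1 + norm (w - z))) powr (- b)"
      by (intro powr_mono2 le) auto
    then have "(1 + norm w) powr (- b) \<le> (1 + norm z) powr (- b) * (1 + norm (z - w)) powr (- b)"
      by (simp add: powr_mult norm_minus_commute)
    moreover have "inverse x \<le> inverse y * k" if "y \<le> x * k" "0 < x" "0 < y" for x y k :: real
      using that by (simp add: field_simps)
    moreover have "0 < 1 + norm w" "0 < 1 + norm z" by (simp_all add: add_pos_nonneg)
    ultimately have "inverse ((1 + norm z) powr (- b)) \<le>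
        inverse ((1 + norm w) powr (- b)) * (1 + norm (z - w)) powr (- b)"
      by simp
    then show ?thesis
      unfolding powr_minus[symmetric] minus_minus using False by simp
  qed
qed

section \<open>Translation invariance and Gaussian integrals for \<open>dV\<close>\<close>

lemma nn_integral_dV_eq:
  fixes f :: "complex ^ 'n \<Rightarrow> ennreal"
  assumes "f \<in> borel_measurable borel"
  shows "(\<integral>\<^sup>+u. f u \<partial>dV) = ennreal (1 / pi ^ CARD('n)) * (\<integral>\<^sup>+u. f u \<partial>lborel)"
  unfolding dV_def using assms by (simp add: nn_integral_scale_measure)

lemma nn_integral_dV_translate:
  fixes f :: "complex ^ 'n \<Rightarrow> ennreal"
  assumes [measurable]: "f \<in> borel_measurable borel"
  shows "(\<integral>\<^sup>+u. f (u - w) \<partial>dV) = (\<integral>\<^sup>+u. f u \<partial>dV)"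
proof -
  have "(\<integral>\<^sup>+u. f u \<partial>lborel) = (\<integral>\<^sup>+u. f u \<partial>distr lborel borel ((+) (- w)))"
    by (simp add: lborel_distr_plus)
  also have "\<dots> = (\<integral>\<^sup>+u. f (u - w) \<partial>lborel)" by (subst nn_integral_distr) auto
  finally show ?thesis by (simp add: nn_integral_dV_eq)
qed

text \<open>Scaling by \<open>s\<close> with \<open>\<kappa> * s\<^sup>2 = 1\<close> reduces this to
  the normalised Gaussian.\<close>

lemma nn_integral_gaussian_dV_finite:
  assumes "0 < \<kappa>"
  shows "(\<integral>\<^sup>+u. ennreal (exp (- \<kappa> * (norm u)\<^sup>2)) \<partial>(dV :: (complex ^ 'n) measure)) < \<infinity>"
proof -
  define s where "s = 1 / sqrt \<kappa>"
  have s: "0 < s" "\<kappa> * s\<^sup>2 = 1" using assms by (simp_all add: s_def power_divide)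
  have "(\<integral>\<^sup>+u. ennreal (exp (- (norm u)\<^sup>2)) \<partial>(lborel :: (complex ^ 'n) measure)) < \<infinity>"
    using nn_integral_lborel_eq_dV[of "\<lambda>u :: complex ^ 'n. ennreal (exp (- (norm u)\<^sup>2))"]
    by (simp add: dV_normalized)
  moreover have "(\<integral>\<^sup>+u. ennreal (exp (- \<kappa> * (norm u)\<^sup>2)) \<partial>(lborel :: (complex ^ 'n) measure)) =
      ennreal (s ^ DIM(complex ^ 'n)) *
      (\<integral>\<^sup>+u. ennreal (exp (- (norm u)\<^sup>2)) \<partial>(lborel :: (complex ^ 'n) measure))"
    using s by (subst lborel_affine[of s 0])
      (simp_all add: nn_integral_density nn_integral_distr nn_integral_cmult power_mult_distrib
        mult.assoc[symmetric])
  ultimately show ?thesis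
    by (simp add: nn_integral_dV_eq ennreal_mult_less_top)
qed

text \<open>Half of the Gaussian absorbs the polynomial factor: \<open>1 + t \<le> exp t\<close>,
  and completing the square bounds \<open>b * t\<close> by a constant plus
  \<open>\<kappa> / 2 * t\<^sup>2\<close>.\<close>

lemma nn_integral_gaussian_weight_dV_finite:
  assumes "0 < \<kappa>" "0 \<le> b"
  shows "(\<integral>\<^sup>+u. ennreal (exp (- \<kappa> * (norm u)\<^sup>2) * (1 + norm u) powr b) \<partial>(dV :: (complex ^ 'n) measure)) < \<infinity>"
proof -
  have le: "exp (- \<kappa> * t\<^sup>2) * (1 + t) powr b \<le> exp (b\<^sup>2 / (2 * \<kappa>)) * exp (- (\<kappa> / 2) * t\<^sup>2)" if "0 \<le> t" for t
  proof -
    have "(1 + t) powr b \<le> exp t powr b"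
      using that assms by (intro powr_mono2) auto
    moreover have "b * t \<le> b\<^sup>2 / (2 * \<kappa>) + \<kappa> / 2 * t\<^sup>2"
    proof -
      have "0 \<le> (b - \<kappa> * t)\<^sup>2 / (2 * \<kappa>)" using assms by simp
      also have "\<dots> = b\<^sup>2 / (2 * \<kappa>) + \<kappa> / 2 * t\<^sup>2 - b * t"
        using assms by (simp add: power2_diff field_simps power2_eq_square)
      finally show ?thesis by simp
    qed
    ultimately have "(1 + t) powr b \<le> exp (b\<^sup>2 / (2 * \<kappa>) + \<kappa> / 2 * t\<^sup>2)"
      by (simp add: exp_powr_real mult.commute order_trans)
    then have "exp (- \<kappa> * t\<^sup>2) * (1 + t) powr b \<le> exp (- \<kappa> * t\<^sup>2) * exp (b\<^sup>2 / (2 * \<kappa>) + \<kappa> / 2 * t\<^sup>2)"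
      by (rule mult_left_mono) simp
    also have "\<dots> = exp (b\<^sup>2 / (2 * \<kappa>)) * exp (- (\<kappa> / 2) * t\<^sup>2)"
      by (simp flip: exp_add)
    finally show ?thesis .
  qed
  have "(\<integral>\<^sup>+u. ennreal (exp (- \<kappa> * (norm u)\<^sup>2) * (1 + norm u) powr b) \<partial>(dV :: (complex ^ 'n) measure))
     \<le> (\<integral>\<^sup>+u. ennreal (exp (b\<^sup>2 / (2 * \<kappa>))) * ennreal (exp (- (\<kappa> / 2) * (norm u)\<^sup>2)) \<partial>(dV :: (complex ^ 'n) measure))"
    by (intro nn_integral_mono) (simp only: ennreal_mult'[symmetric] exp_ge_zero ennreal_leI le norm_ge_zero)
  also have "\<dots> = ennreal (exp (b\<^sup>2 / (2 * \<kappa>))) *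
      (\<integral>\<^sup>+u. ennreal (exp (- (\<kappa> / 2) * (norm u)\<^sup>2)) \<partial>(dV :: (complex ^ 'n) measure))"
    by (rule nn_integral_cmult) (simp add: dV_def)
  also have "\<dots> < \<infinity>"
    using nn_integral_gaussian_dV_finite[where \<kappa> = "\<kappa> / 2" and 'n = 'n] assms by (simp add: ennreal_mult_less_top)
  finally show ?thesis .
qed

text \<open>The scale \<open>c\<close> stays free: the Carleson case tests with
  \<open>c = 1\<close>, the vanishing case with a power of \<open>1 + norm w\<close> that keeps the
  norms bounded.\<close>

definition fock_kernel :: "real \<Rightarrow> complex ^ 'n \<Rightarrow> complex ^ 'n \<Rightarrow> complex" where
  "fock_kernel c w z = of_real c * exp (hermitian z w + of_real (- (norm w)\<^sup>2 / 2))"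

lemma entire_fock_kernel: "entire (fock_kernel c w)"
proof -
  have "entire (\<lambda>_ :: complex ^ 'n. complex_of_real c)"
    unfolding entire_def by (auto intro!: exI[of _ "\<lambda>_. 0"])
  from entire_twist[OF this, of w "of_real (- (norm w)\<^sup>2 / 2)"] show ?thesis
    by (simp only: fock_kernel_def[abs_def])
qed

lemma cmod_fock_kernel: "0 \<le> c \<Longrightarrow> cmod (fock_kernel c w z) = c * exp (z \<bullet> w - (norm w)\<^sup>2 / 2)"
  by (simp add: fock_kernel_def norm_mult Re_hermitian)

lemma weighted_power_fock_kernel:
  assumes "0 \<le> c"
  shows "weighted_power p (fock_kernel c w) z = c powr p * exp (- (p / 2) * (norm (z - w))\<^sup>2)"
  unfolding weighted_power_eq cmod_fock_kernel[OF assms] power2_norm_eq_inner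
  using assms by (simp add: powr_mult exp_powr_real algebra_simps inner_commute
      add_divide_distrib diff_divide_distrib flip: exp_add)

text \<open>Peetre's inequality moves the weight from \<open>z\<close> to \<open>w\<close>;
  translation invariance then leaves a Gaussian integral that no longer depends on
  \<open>w\<close>.\<close>

lemma fock_integral_fock_kernel_le:
  assumes "0 < p"
  obtains A :: real where "0 < A"
    "\<And>(w :: complex ^ 'n) c. 0 \<le> c \<Longrightarrow>
       fock_integral p \<alpha> (fock_kernel c w) \<le> ennreal (A * (c powr p * (1 + norm w) powr (- \<alpha>)))"
proof -
  let ?A = "\<integral>\<^sup>+u. ennreal (exp (- (p / 2) * (norm u)\<^sup>2) * (1 + norm u) powr \<bar>\<alpha>\<bar>) \<partial>(dV :: (complex ^ 'n) measure)"
  have "?A < \<infinity>" using assms by (intro nn_integral_gaussian_weight_dV_finite) auto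
  then obtain A where A: "?A = ennreal A" "0 \<le> A" by (cases ?A) auto
  \<comment> \<open>Only \<open>0 \<le> A\<close> is known at this point; \<open>A + 1\<close> makes
    the constant positive.\<close>
  have main: "fock_integral p \<alpha> (fock_kernel c w) \<le> ennreal ((A + 1) * (c powr p * (1 + norm w) powr (- \<alpha>)))"
    if c: "0 \<le> c" for w :: "complex ^ 'n" and c
  proof -
    let ?k = "c powr p * (1 + norm w) powr (- \<alpha>)"
    let ?h = "\<lambda>u :: complex ^ 'n. ennreal (exp (- (p / 2) * (norm u)\<^sup>2) * (1 + norm u) powr \<bar>\<alpha>\<bar>)"
    have "fock_integral p \<alpha> (fock_kernel c w) \<le> (\<integral>\<^sup>+z. ennreal ?k * ?h (z - w) \<partial>dV)"
      unfolding fock_integral_def weighted_power_fock_kernel[OF c]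
    proof (rule nn_integral_mono)
      fix z
      have "c powr p * exp (- (p / 2) * (norm (z - w))\<^sup>2) * (1 + norm z) powr (- \<alpha>)
         \<le> c powr p * exp (- (p / 2) * (norm (z - w))\<^sup>2) *
            ((1 + norm w) powr (- \<alpha>) * (1 + norm (z - w)) powr \<bar>\<alpha>\<bar>)"
        using peetre_inequality[of z "- \<alpha>" w] by (intro mult_left_mono) auto
      then show "ennreal (c powr p * exp (- (p / 2) * (norm (z - w))\<^sup>2) * (1 + norm z) powr (- \<alpha>))
        \<le> ennreal ?k * ?h (z - w)"
        by (simp add: ac_simps flip: ennreal_mult')
    qed
    also have "\<dots> = ennreal ?k * (\<integral>\<^sup>+z. ?h (z - w) \<partial>dV)"
      by (rule nn_integral_cmult) (simp add: dV_def)
    also have "(\<integral>\<^sup>+z. ?h (z - w) \<partial>dV) = ?A"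
      by (rule nn_integral_dV_translate) simp
    also have "ennreal ?k * ?A \<le> ennreal ((A + 1) * ?k)"
      unfolding A(1) using A(2)
      by (subst ennreal_mult[symmetric]) (auto intro!: ennreal_leI simp: algebra_simps)
    finally show ?thesis .
  qed
  show thesis
    by (rule that[OF _ main]) (use A in auto)
qed

text \<open>A Chebyshev argument: on \<open>ball w r\<close> the weighted power of the kernel is at
  least \<open>c powr p * exp (- (p / 2) * r\<^sup>2)\<close>.\<close>

lemma emeasure_ball_le_fock_kernel:
  fixes \<mu> :: "(complex ^ 'n) measure"
  assumes sets: "sets \<mu> = sets borel" and "0 < p" "0 \<le> c"
  shows "emeasure \<mu> (ball w r) * ennreal (c powr p) \<le>
     ennreal (exp (p / 2 * r\<^sup>2)) * (\<integral>\<^sup>+z. ennreal (weighted_power p (fock_kernel c w) z) \<partial>\<mu>)"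
proof -
  note [measurable_cong] = sets
  have "emeasure \<mu> (ball w r) * ennreal (c powr p) = (\<integral>\<^sup>+z. ennreal (c powr p) * indicator (ball w r) z \<partial>\<mu>)"
    by (simp add: nn_integral_cmult_indicator sets mult.commute)
  also have "\<dots> \<le> (\<integral>\<^sup>+z. ennreal (exp (p / 2 * r\<^sup>2)) * ennreal (weighted_power p (fock_kernel c w) z) \<partial>\<mu>)"
  proof (rule nn_integral_mono)
    fix z
    have "c powr p \<le> exp (p / 2 * r\<^sup>2) * weighted_power p (fock_kernel c w) z" if "z \<in> ball w r"
    proof -
      have "(norm (z - w))\<^sup>2 \<le> r\<^sup>2"
        using that by (intro power_mono) (auto simp: dist_norm norm_minus_commute)
      then have "1 \<le> exp (p / 2 * r\<^sup>2 + - (p / 2) * (norm (z - w))\<^sup>2)"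
        using \<open>0 < p\<close> by simp
      from mult_left_mono[OF this, of "c powr p"]
      show ?thesis unfolding weighted_power_fock_kernel[OF \<open>0 \<le> c\<close>] exp_add by (simp add: ac_simps)
    qed
    then show "ennreal (c powr p) * indicator (ball w r) z
      \<le> ennreal (exp (p / 2 * r\<^sup>2)) * ennreal (weighted_power p (fock_kernel c w) z)"
      by (auto simp: indicator_def intro!: ennreal_leI simp flip: ennreal_mult')
  qed
  also have "\<dots> = ennreal (exp (p / 2 * r\<^sup>2)) * (\<integral>\<^sup>+z. ennreal (weighted_power p (fock_kernel c w) z) \<partial>\<mu>)"
    using measurable_compose[OF measurable_weighted_power[OF entire_fock_kernel] measurable_ennreal]
    by (intro nn_integral_cmult) (simp add: measurable_cong_sets[OF sets refl])
  finally show ?thesis .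
qed

text \<open>Membership in the space makes the integral finite, so \<open>enn2real\<close> loses
  nothing.\<close>

lemma fock_norm_powr:
  assumes "0 < p" "f \<in> fock_space p \<alpha>"
  shows "ennreal (fock_norm p \<alpha> f powr p) = fock_integral p \<alpha> f"
  using assms by (simp add: fock_norm_def fock_space_def powr_powr)

section \<open>Carleson measures\<close>

lemma carleson_measure_iff:
  assumes "0 < p"
  shows "carleson_measure p \<alpha> \<mu> \<longleftrightarrow> (\<exists>C>0. \<forall>f\<in>fock_space p \<alpha>.
    (\<integral>\<^sup>+z. ennreal (weighted_power p f z) \<partial>\<mu>) \<le> ennreal C * fock_integral p \<alpha> f)"
  unfolding carleson_measure_def using assms
  by (intro ex_cong1 conj_cong ball_cong refl) (simp add: ennreal_mult' fock_norm_powr)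

text \<open>Testing on \<open>fock_kernel 1 w\<close>: its \<open>\<mu>\<close>-integral dominates
  the measure of the ball up to a constant, and its Fock integral is at most a constant times
  \<open>(1 + norm w) powr (- \<alpha>)\<close>.\<close>

lemma carleson_imp_ball_bound:
  fixes \<mu> :: "(complex ^ 'n) measure"
  assumes p: "0 < p" and sets: "sets \<mu> = sets borel" and carleson: "carleson_measure p \<alpha> \<mu>"
  shows "\<exists>C>0. \<forall>z. emeasure \<mu> (ball z r) \<le> ennreal (C / (1 + norm z) powr \<alpha>)"
proof -
  obtain C where C: "0 < C" "\<And>f. f \<in> fock_space p \<alpha> \<Longrightarrow>
      (\<integral>\<^sup>+z. ennreal (weighted_power p f z) \<partial>\<mu>) \<le> ennreal C * fock_integral p \<alpha> f"
    using carleson unfolding carleson_measure_iff[OF p] by blast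
  obtain A :: real where A: "0 < A" "\<And>(w :: complex ^ 'n) c. 0 \<le> c \<Longrightarrow>
      fock_integral p \<alpha> (fock_kernel c w) \<le> ennreal (A * (c powr p * (1 + norm w) powr (- \<alpha>)))"
    by (rule fock_integral_fock_kernel_le[OF p]) (rule that; blast)
  let ?E = "exp (p / 2 * r\<^sup>2)"
  have "emeasure \<mu> (ball w r) \<le> ennreal (?E * C * A / (1 + norm w) powr \<alpha>)" for w
  proof -
    have int: "fock_integral p \<alpha> (fock_kernel 1 w) \<le> ennreal (A * (1 + norm w) powr (- \<alpha>))"
      using A(2)[of 1 w] by simp
    then have "fock_kernel 1 w \<in> fock_space p \<alpha>"
      by (simp add: fock_space_def entire_fock_kernel le_less_trans)
    have "emeasure \<mu> (ball w r) \<le> ennreal ?E * (\<integral>\<^sup>+z. ennreal (weighted_power p (fock_kernel 1 w) z) \<partial>\<mu>)"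
      using emeasure_ball_le_fock_kernel[OF sets p, of 1 w r] by simp
    also have "\<dots> \<le> ennreal ?E * (ennreal C * ennreal (A * (1 + norm w) powr (- \<alpha>)))"
      using C(2)[OF \<open>fock_kernel 1 w \<in> _\<close>] mult_left_mono[OF int, of "ennreal C"]
      by (intro mult_left_mono) auto
    also have "\<dots> = ennreal (?E * C * A / (1 + norm w) powr \<alpha>)"
      using C(1) A(1) by (simp add: powr_minus field_simps flip: ennreal_mult')
    finally show ?thesis .
  qed
  then show ?thesis
    using C(1) A(1) by (intro exI[of _ "?E * C * A"]) simp
qed

lemma ball_bound_imp_carleson:
  fixes \<mu> :: "(complex ^ 'n) measure"
  assumes p: "0 < p" and r: "0 < r" and sets: "sets \<mu> = sets borel"
    and C: "0 < C" "\<And>z. emeasure \<mu> (ball z r) \<le> ennreal (C / (1 + norm z) powr \<alpha>)"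
  shows "carleson_measure p \<alpha> \<mu>"
proof -
  have fin: "finite_on_compacts \<mu>"
    by (intro finite_on_compacts_if_finite_on_balls[OF sets r])
      (rule le_less_trans[OF C(2)], simp)
  obtain D :: real where D: "0 < D"
    "\<And>f. entire f \<Longrightarrow> (\<integral>\<^sup>+z. ennreal (weighted_power p f z) \<partial>\<mu>) \<le>
       ennreal D * (\<integral>\<^sup>+u. ennreal (weighted_power p f u) * emeasure \<mu> (ball u r) \<partial>dV)"
    by (rule nn_integral_weighted_power_le[OF p r sets fin]) (rule that; blast)
  have "(\<integral>\<^sup>+z. ennreal (weighted_power p f z) \<partial>\<mu>) \<le> ennreal (D * C) * fock_integral p \<alpha> f"
    if "f \<in> fock_space p \<alpha>" for f
  proof -
    have f: "entire f" using that by (simp add: fock_space_def)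
    note [measurable] = measurable_weighted_power[OF f, of p]
    have "(\<integral>\<^sup>+u. ennreal (weighted_power p f u) * emeasure \<mu> (ball u r) \<partial>dV)
       \<le> (\<integral>\<^sup>+u. ennreal C * ennreal (weighted_power p f u * (1 + norm u) powr (- \<alpha>)) \<partial>dV)"
    proof (rule nn_integral_mono)
      fix u :: "complex ^ 'n"
      have "ennreal (weighted_power p f u) * emeasure \<mu> (ball u r)
          \<le> ennreal (weighted_power p f u) * ennreal (C / (1 + norm u) powr \<alpha>)"
        by (rule mult_left_mono[OF C(2)]) simp
      also have "\<dots> = ennreal C * ennreal (weighted_power p f u * (1 + norm u) powr (- \<alpha>))"
        using C(1) by (simp add: weighted_power_nonneg powr_minus divide_inverse ac_simps flip: ennreal_mult')
      finally show "ennreal (weighted_power p f u) * emeasure \<mu> (ball u r)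
          \<le> ennreal C * ennreal (weighted_power p f u * (1 + norm u) powr (- \<alpha>))" .
    qed
    also have "\<dots> = ennreal C * fock_integral p \<alpha> f"
      unfolding fock_integral_def by (rule nn_integral_cmult) (simp add: dV_def)
    finally have "ennreal D * (\<integral>\<^sup>+u. ennreal (weighted_power p f u) * emeasure \<mu> (ball u r) \<partial>dV)
        \<le> ennreal D * (ennreal C * fock_integral p \<alpha> f)"
      by (rule mult_left_mono) simp
    then show ?thesis
      using D(1) C(1) order_trans[OF D(2)[OF f]] by (simp add: ennreal_mult' mult.assoc)
  qed
  then show ?thesis
    unfolding carleson_measure_iff[OF p] using D(1) C(1) by (intro exI[of _ "D * C"]) simp
qed

section \<open>Vanishing Carleson measures\<close>

lemma uniform_limit_fock_kernel:
  fixes w :: "nat \<Rightarrow> complex ^ 'n"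
  assumes w: "filterlim (\<lambda>j. norm (w j)) at_top sequentially" and K: "compact K"
  shows "uniform_limit K (\<lambda>j. fock_kernel ((1 + norm (w j)) powr b) (w j)) (\<lambda>_. 0) sequentially"
proof -
  obtain R where R: "\<And>z. z \<in> K \<Longrightarrow> norm z \<le> R"
    using compact_imp_bounded[OF K] unfolding bounded_iff by blast
  \<comment> \<open>By Cauchy-Schwarz this bounds the modulus of the kernel for
    \<open>norm z \<le> R\<close> with \<open>t = norm (w j)\<close>; the Gaussian factor beats both
    the power and \<open>exp (R * t)\<close>.\<close>
  let ?h = "\<lambda>t :: real. (1 + t) powr b * exp (R * t - t\<^sup>2 / 2)"
  have "(?h \<longlongrightarrow> 0) at_top" by real_asymp
  then have lim: "(\<lambda>j. ?h (norm (w j))) \<longlonglongrightarrow> 0" by (rule filterlim_compose[OF _ w])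
  show ?thesis
  proof (rule uniform_limitI)
    fix e :: real assume "0 < e"
    with lim have "\<forall>\<^sub>F j in sequentially. ?h (norm (w j)) < e" by (rule order_tendstoD)
    then show "\<forall>\<^sub>F j in sequentially. \<forall>z\<in>K. dist (fock_kernel ((1 + norm (w j)) powr b) (w j) z) 0 < e"
    proof (eventually_elim, intro ballI)
      fix j z assume j: "?h (norm (w j)) < e" and z: "z \<in> K"
      have "z \<bullet> w j \<le> norm z * norm (w j)" by (rule norm_cauchy_schwarz)
      also have "\<dots> \<le> R * norm (w j)" using R[OF z] by (rule mult_right_mono) simp
      finally have "(1 + norm (w j)) powr b * exp (z \<bullet> w j - (norm (w j))\<^sup>2 / 2) \<le> ?h (norm (w j))"
        by (intro mult_left_mono) auto
      with j show "dist (fock_kernel ((1 + norm (w j)) powr b) (w j) z) 0 < e"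
        by (simp add: cmod_fock_kernel)
    qed
  qed
qed

lemma vanishing_carleson_imp_ball_limit:
  fixes \<mu> :: "(complex ^ 'n) measure"
  assumes p: "0 < p" and sets: "sets \<mu> = sets borel" and vanishing: "vanishing_carleson_measure p \<alpha> \<mu>"
  shows "((\<lambda>z. emeasure \<mu> (ball z r) * ennreal ((1 + norm z) powr \<alpha>)) \<longlongrightarrow> 0) at_infinity"
proof (rule order_tendstoI)
  fix e :: ennreal assume e: "0 < e"
  show "\<forall>\<^sub>F z in at_infinity. emeasure \<mu> (ball z r) * ennreal ((1 + norm z) powr \<alpha>) < e"
  proof (rule ccontr)
    assume "\<not> ?thesis"
    then have "\<exists>z. real j \<le> norm z \<and> e \<le> emeasure \<mu> (ball z r) * ennreal ((1 + norm z) powr \<alpha>)" for j :: nat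
      unfolding eventually_at_infinity by (meson not_less)
    \<comment> \<open>Failure of the limit supplies points \<open>w j\<close> tending to infinity
      along which the weighted measure stays at least \<open>e\<close>; the kernels at these points
      will contradict the vanishing property.\<close>
    then obtain w where w: "\<And>j :: nat. real j \<le> norm (w j)"
      "\<And>j. e \<le> emeasure \<mu> (ball (w j) r) * ennreal ((1 + norm (w j)) powr \<alpha>)"
      by metis
    \<comment> \<open>With this exponent \<open>c j powr p\<close> cancels the weight in the bound
      on the Fock integral, so the kernels are bounded in the space, and it supplies exactly the
      factor \<open>(1 + norm (w j)) powr \<alpha>\<close> in the ball estimate.\<close>
    define c where "c j = (1 + norm (w j)) powr (\<alpha> / p)" for j
    define f where "f j = fock_kernel (c j) (w j)" for j
    have c: "0 \<le> c j" "c j powr p = (1 + norm (w j)) powr \<alpha>" for j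
      using p by (simp_all add: c_def powr_powr)
    obtain A :: real where A: "0 < A" "\<And>(w :: complex ^ 'n) c. 0 \<le> c \<Longrightarrow>
        fock_integral p \<alpha> (fock_kernel c w) \<le> ennreal (A * (c powr p * (1 + norm w) powr (- \<alpha>)))"
      by (rule fock_integral_fock_kernel_le[OF p]) (rule that; blast)
    have int: "fock_integral p \<alpha> (f j) \<le> ennreal A" for j
    proof -
      have "0 < 1 + norm (w j)" by (simp add: add_pos_nonneg)
      then show ?thesis
        using A(2)[OF c(1), of j "w j"] unfolding c(2) f_def by (simp flip: powr_add)
    qed
    have "f j \<in> fock_space p \<alpha>" for j
      using int[of j] by (simp add: fock_space_def f_def entire_fock_kernel le_less_trans)
    moreover have "fock_norm p \<alpha> (f j) \<le> A powr (1 / p)" for j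
      unfolding fock_norm_def using p A(1) enn2real_mono[OF int[of j]]
      by (intro powr_mono2) auto
    moreover have "filterlim (\<lambda>j. norm (w j)) at_top sequentially"
      by (rule filterlim_at_top_mono[OF filterlim_real_sequentially]) (simp add: w(1))
    then have "uniform_limit K f (\<lambda>_. 0) sequentially" if "compact K" for K
      using uniform_limit_fock_kernel[OF _ that] unfolding f_def[abs_def] c_def by blast
    ultimately have "(\<lambda>j. \<integral>\<^sup>+z. ennreal (weighted_power p (f j) z) \<partial>\<mu>) \<longlonglongrightarrow> 0"
      using vanishing unfolding vanishing_carleson_measure_def by blast
    then have "(\<lambda>j. ennreal (exp (p / 2 * r\<^sup>2)) * (\<integral>\<^sup>+z. ennreal (weighted_power p (f j) z) \<partial>\<mu>))
        \<longlonglongrightarrow> ennreal (exp (p / 2 * r\<^sup>2)) * 0"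
      by (intro ennreal_tendsto_cmult) auto
    then have "\<forall>\<^sub>F j in sequentially.
        ennreal (exp (p / 2 * r\<^sup>2)) * (\<integral>\<^sup>+z. ennreal (weighted_power p (f j) z) \<partial>\<mu>) < e"
      using e by (intro order_tendstoD) auto
    then obtain j where "ennreal (exp (p / 2 * r\<^sup>2)) * (\<integral>\<^sup>+z. ennreal (weighted_power p (f j) z) \<partial>\<mu>) < e"
      by (auto dest: eventually_happens)
    with emeasure_ball_le_fock_kernel[OF sets p c(1)[of j], of "w j" r] w(2)[of j] show False
      unfolding c(2) f_def by (meson leD order_trans)
  qed
qed simp

lemma ball_limit_imp_vanishing_carleson:
  fixes \<mu> :: "(complex ^ 'n) measure"
  assumes p: "0 < p" and r: "0 < r" and sets: "sets \<mu> = sets borel" and fin: "finite_on_compacts \<mu>"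
    and lim: "((\<lambda>z. emeasure \<mu> (ball z r) * ennreal ((1 + norm z) powr \<alpha>)) \<longlongrightarrow> 0) at_infinity"
  shows "vanishing_carleson_measure p \<alpha> \<mu>"
  unfolding vanishing_carleson_measure_def
proof (intro allI impI)
  fix f :: "nat \<Rightarrow> complex ^ 'n \<Rightarrow> complex"
  assume f: "\<forall>j. f j \<in> fock_space p \<alpha>" and bounded: "\<exists>M. \<forall>j. fock_norm p \<alpha> (f j) \<le> M"
    and unif: "\<forall>K. compact K \<longrightarrow> uniform_limit K f (\<lambda>z. 0) sequentially"
  let ?X = "\<lambda>j. \<integral>\<^sup>+z. ennreal (weighted_power p (f j) z) \<partial>\<mu>"
  have entire: "entire (f j)" for j using f by (simp add: fock_space_def)
  note wp[measurable] = measurable_weighted_power[OF entire, of p]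
  obtain D :: real where D: "0 < D"
    "\<And>f. entire f \<Longrightarrow> (\<integral>\<^sup>+z. ennreal (weighted_power p f z) \<partial>\<mu>) \<le>
       ennreal D * (\<integral>\<^sup>+u. ennreal (weighted_power p f u) * emeasure \<mu> (ball u r) \<partial>dV)"
    by (rule nn_integral_weighted_power_le[OF p r sets fin]) (rule that; blast)
  obtain M where M: "\<And>j. fock_norm p \<alpha> (f j) \<le> M" using bounded by blast
  define N where "N = M powr p"
  have N: "0 \<le> N" "fock_integral p \<alpha> (f j) \<le> ennreal N" for j
  proof -
    show "0 \<le> N" by (simp add: N_def)
    have "fock_norm p \<alpha> (f j) powr p \<le> N"
      unfolding N_def using p M[of j] by (intro powr_mono2) (auto simp: fock_norm_def)
    then show "fock_integral p \<alpha> (f j) \<le> ennreal N"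
      using fock_norm_powr[OF p, of "f j" \<alpha>] f by (metis ennreal_leI)
  qed
  \<comment> \<open>The large ball contributes at most \<open>e\<close> and its complement at most
    \<open>e * N\<close>; \<open>D\<close> comes from exchanging the integrals.\<close>
  have small: "\<forall>\<^sub>F j in sequentially. ?X j \<le> ennreal (D * (1 + N) * e)" if e: "0 < e" for e :: real
  proof -
    have "\<forall>\<^sub>F z in at_infinity. emeasure \<mu> (ball z r) * ennreal ((1 + norm z) powr \<alpha>) < ennreal e"
      using order_tendstoD(2)[OF lim, of "ennreal e"] e by simp
    then obtain R where R: "\<And>z. R \<le> norm z \<Longrightarrow> emeasure \<mu> (ball z r) * ennreal ((1 + norm z) powr \<alpha>) < ennreal e"
      unfolding eventually_at_infinity by blast
    let ?K = "cball 0 \<bar>R\<bar> :: (complex ^ 'n) set"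
    \<comment> \<open>Every ball of radius \<open>r\<close> centred in \<open>?K\<close> lies in
      this larger compact ball, so \<open>T\<close> bounds all their measures.\<close>
    have "emeasure \<mu> (cball 0 (\<bar>R\<bar> + r)) < \<infinity>" using fin unfolding finite_on_compacts_def by simp
    then obtain T where T: "0 \<le> T" "emeasure \<mu> (cball 0 (\<bar>R\<bar> + r)) = ennreal T"
      by (cases "emeasure \<mu> (cball 0 (\<bar>R\<bar> + r))") auto
    have "emeasure lborel ?K < \<infinity>" by (rule emeasure_compact_finite) simp
    then have "emeasure (dV :: (complex ^ 'n) measure) ?K < \<infinity>"
      by (simp add: dV_def ennreal_mult_less_top)
    then obtain V where V: "0 \<le> V" "emeasure (dV :: (complex ^ 'n) measure) ?K = ennreal V"
      by (cases "emeasure (dV :: (complex ^ 'n) measure) ?K") auto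
    \<comment> \<open>Uniform smallness \<open>\<delta>\<close> on \<open>?K\<close> makes the part
      over \<open>?K\<close> at most \<open>\<delta> powr p * T * V\<close>, which this choice keeps
      below \<open>e\<close>; the summand \<open>1\<close> avoids a zero denominator.\<close>
    define \<delta> where "\<delta> = (e / (1 + T * V)) powr (1 / p)"
    have TV: "0 < 1 + T * V" using T(1) V(1) by (simp add: add_pos_nonneg)
    then have \<delta>: "0 < \<delta>" "\<delta> powr p = e / (1 + T * V)"
      using e p by (simp_all add: \<delta>_def powr_powr)
    have \<delta>e: "T * V * \<delta> powr p \<le> e"
      unfolding \<delta>(2) using e TV T(1) V(1) by (simp add: field_simps)
    have "\<forall>\<^sub>F j in sequentially. \<forall>z\<in>?K. dist (f j z) 0 < \<delta>"
      using unif \<delta>(1) by (intro uniform_limitD) auto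
    then show ?thesis
    proof eventually_elim
      case (elim j)
      \<comment> \<open>The first summand dominates the integrand on \<open>?K\<close>, by uniform
        convergence; the second dominates it off \<open>?K\<close>, by the growth condition.\<close>
      have "(\<integral>\<^sup>+u. ennreal (weighted_power p (f j) u) * emeasure \<mu> (ball u r) \<partial>dV) \<le>
        (\<integral>\<^sup>+u. ennreal (\<delta> powr p * T) * indicator ?K u +
          ennreal e * ennreal (weighted_power p (f j) u * (1 + norm u) powr (- \<alpha>)) \<partial>dV)"
      proof (rule nn_integral_mono)
        fix u :: "complex ^ 'n"
        show "ennreal (weighted_power p (f j) u) * emeasure \<mu> (ball u r) \<le>
          ennreal (\<delta> powr p * T) * indicator ?K u +
          ennreal e * ennreal (weighted_power p (f j) u * (1 + norm u) powr (- \<alpha>))"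
        proof (cases "u \<in> ?K")
          case True
          have "cmod (f j u) powr p \<le> \<delta> powr p"
            using elim True p by (intro powr_mono2) (auto simp: less_imp_le)
          moreover have "exp (- p * (norm u)\<^sup>2 / 2) \<le> 1" using p by simp
          ultimately have "weighted_power p (f j) u \<le> \<delta> powr p * 1"
            unfolding weighted_power_eq by (rule mult_mono) auto
          moreover have "emeasure \<mu> (ball u r) \<le> ennreal T"
            unfolding T(2)[symmetric]
          proof (rule emeasure_mono)
            show "ball u r \<subseteq> cball 0 (\<bar>R\<bar> + r)"
            proof
              fix x assume "x \<in> ball u r"
              then show "x \<in> cball 0 (\<bar>R\<bar> + r)"
                using True dist_triangle[of 0 x u] by (simp only: mem_ball mem_cball)
            qed
          qed (simp add: sets)
          ultimately have "ennreal (weighted_power p (f j) u) * emeasure \<mu> (ball u r) \<le> ennreal (\<delta> powr p) * ennreal T"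
            by (intro mult_mono ennreal_leI) auto
          then show ?thesis
            using True T(1) by (simp add: ennreal_mult' add_increasing2)
        next
          case False
          have pos: "0 < (1 + norm u) powr \<alpha>" using add_pos_nonneg[of 1 "norm u"] by simp
          have "emeasure \<mu> (ball u r) * ennreal ((1 + norm u) powr \<alpha>) \<le> ennreal e"
            using R[of u] False by (auto simp: less_imp_le)
          then have "emeasure \<mu> (ball u r) * ennreal ((1 + norm u) powr \<alpha>) * ennreal ((1 + norm u) powr (- \<alpha>))
              \<le> ennreal e * ennreal ((1 + norm u) powr (- \<alpha>))"
            by (rule mult_right_mono) simp
          then have "emeasure \<mu> (ball u r) \<le> ennreal e * ennreal ((1 + norm u) powr (- \<alpha>))"
            using pos by (simp add: mult.assoc powr_minus flip: ennreal_mult')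
          then have "ennreal (weighted_power p (f j) u) * emeasure \<mu> (ball u r)
              \<le> ennreal (weighted_power p (f j) u) * (ennreal e * ennreal ((1 + norm u) powr (- \<alpha>)))"
            by (rule mult_left_mono) simp
          then show ?thesis
            using False by (simp add: ennreal_mult weighted_power_nonneg ac_simps)
        qed
      qed
      also have "\<dots> = ennreal (\<delta> powr p * T) * ennreal V + ennreal e * fock_integral p \<alpha> (f j)"
      proof -
        let ?W = "\<lambda>u. ennreal (weighted_power p (f j) u * (1 + norm u) powr (- \<alpha>))"
        have W: "?W \<in> borel_measurable dV"
          using wp[of j] by (simp add: dV_def)
        have "(\<integral>\<^sup>+u. ennreal (\<delta> powr p * T) * indicator ?K u + ennreal e * ?W u \<partial>dV) =
            (\<integral>\<^sup>+u. ennreal (\<delta> powr p * T) * indicator ?K u \<partial>dV) + (\<integral>\<^sup>+u. ennreal e * ?W u \<partial>dV)"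
          by (intro nn_integral_add borel_measurable_times_ennreal borel_measurable_indicator W)
            (simp_all add: dV_def)
        moreover have "(\<integral>\<^sup>+u. ennreal (\<delta> powr p * T) * indicator ?K u \<partial>dV) = ennreal (\<delta> powr p * T) * ennreal V"
          unfolding V(2)[symmetric] by (rule nn_integral_cmult_indicator) (simp add: dV_def)
        moreover have "(\<integral>\<^sup>+u. ennreal e * ?W u \<partial>dV) = ennreal e * fock_integral p \<alpha> (f j)"
          unfolding fock_integral_def by (rule nn_integral_cmult[OF W])
        ultimately show ?thesis by simp
      qed
      also have "\<dots> \<le> ennreal e + ennreal e * ennreal N"
        using \<delta>e V(1) N
        by (intro add_mono mult_left_mono) (auto intro!: ennreal_leI simp: ac_simps simp flip: ennreal_mult')
      also have "\<dots> = ennreal ((1 + N) * e)"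
        using e N(1) by (simp add: algebra_simps flip: ennreal_mult' ennreal_plus)
      finally have "ennreal D * (\<integral>\<^sup>+u. ennreal (weighted_power p (f j) u) * emeasure \<mu> (ball u r) \<partial>dV)
          \<le> ennreal D * ennreal ((1 + N) * e)"
        by (rule mult_left_mono) simp
      then show ?case
        using D(1) order_trans[OF D(2)[OF entire]] by (simp add: mult.assoc ennreal_mult')
    qed
  qed
  show "?X \<longlonglongrightarrow> 0"
  proof (rule order_tendstoI)
    fix a :: ennreal assume "0 < a"
    \<comment> \<open>As \<open>a\<close> may be infinite, a positive real \<open>b\<close> below it
      is chosen first; \<open>e\<close> is then set so that the bound in \<open>small\<close> equals
      \<open>b\<close>.\<close>
    then obtain b' where b': "0 < b'" "b' < a" using dense by blast
    then obtain b where b: "0 < b" "ennreal b < a"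
      by (cases b') (auto simp: less_top[symmetric])
    define e where "e = b / (D * (1 + N))"
    have DN: "0 < D * (1 + N)" using D(1) N(1) by (simp add: add_pos_nonneg)
    then have "0 < e" "D * (1 + N) * e = b" using b(1) unfolding e_def by (auto simp del: mult_eq_0_iff)
    with small[of e] have "\<forall>\<^sub>F j in sequentially. ?X j \<le> ennreal b" by simp
    then show "\<forall>\<^sub>F j in sequentially. ?X j < a"
      by eventually_elim (rule le_less_trans[OF _ b(2)])
  qed simp
qed

theorem theorem5p13:
  fixes p r \<alpha> :: real and \<mu> :: "(complex ^ 'n) measure"
  assumes "0 < p" and "0 < r" and borel: "sets \<mu> = sets borel"
  shows "(carleson_measure p \<alpha> \<mu> \<longleftrightarrow>
            (\<exists>C>0. \<forall>z. emeasure \<mu> (ball z r) \<le> ennreal (C / (1 + norm z) powr \<alpha>))) \<and>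
         (finite_on_compacts \<mu> \<longrightarrow>
            (vanishing_carleson_measure p \<alpha> \<mu> \<longleftrightarrow>
              ((\<lambda>z. emeasure \<mu> (ball z r) * ennreal ((1 + norm z) powr \<alpha>)) \<longlongrightarrow> 0) at_infinity)) \<and>
         (vanishing_carleson_measure p \<alpha> \<mu> \<longrightarrow>
            ((\<lambda>z. emeasure \<mu> (ball z r) * ennreal ((1 + norm z) powr \<alpha>)) \<longlongrightarrow> 0) at_infinity)"
  using carleson_imp_ball_bound[OF assms(1) borel] ball_bound_imp_carleson[OF assms]
    vanishing_carleson_imp_ball_limit[OF assms(1) borel] ball_limit_imp_vanishing_carleson[OF assms]
  by blast

end
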